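(* Let $v_1,\ldots,v_n\in\mathbb{C}^n$ and let $M(v_1,\ldots,v_n)$ be the $n\times n$ matrix with these vectors as columns. If $\det M(v_1,\ldots,v_n)\neq0$, then its argument is the phase difference from the canonical orientation of $\mathbb{C}^n$ to the orientation of the basis $(v_1,\ldots,v_n)$.
   Context: Bases are ordered. For a complex subspace $V\subset\mathbb{C}^n$, $GL^+(V)=\{T\in GL(V):\det T>0\}$ (meaning $\det T$ is a positive real number). The set of (complex) orientations of $V$ is $\mathcal{O}_V=\{\text{bases }\beta\text{ of }V\}/\!\sim$, where $\beta_1\sim\beta_2$ if $\beta_2=S(\beta_1)$ for some $S\in GL^+(V)$. The canonical orientation of $\mathbb{C}^n$ is that of its canonical basis. Given bases $\beta_0$ and $\beta=T(\beta_0)$ of $V$, with $T\in GL(V)$ and $\det T=re^{\mathrm{i}\varphi}$ ($r>0$, $\varphi\in[0,2\pi)$), the number $\varphi$ depends only on the orientations of $\beta_0$ and $\beta$, and is called the phase difference from the orientation of $\beta_0$ to that of $\beta$. *)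

theory Defs
  imports
    "HOL-Analysis.Complex_Transcendental"
    "Jordan_Normal_Form.Determinant"
    "Jordan_Normal_Form.VS_Connect"
begin

text \<open>
  A complex subspace of \<open>\<complex>\<^sup>n\<close> is a set \<open>V \<subseteq> carrier_vec n\<close>, viewed as a vector space with the
  operations of \<open>\<complex>\<^sup>n\<close>; \<open>\<complex>\<^sup>n\<close> itself is \<open>carrier_vec n\<close>. Bases are ordered, hence lists.
\<close>

abbreviation subsp :: "nat \<Rightarrow> complex vec set \<Rightarrow> (complex, complex vec) module" where
  "subsp n V \<equiv> (module_vec TYPE(complex) n)\<lparr>carrier := V\<rparr>"

definition ordered_basis :: "nat \<Rightarrow> complex vec set \<Rightarrow> complex vec list \<Rightarrow> bool" where
  "ordered_basis n V \<beta> \<longleftrightarrow> distinct \<beta> \<and> vectorspace.basis class_ring (subsp n V) (set \<beta>)"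

text \<open>Only the values on \<open>V\<close> of an element of \<open>GL n V\<close> matter.\<close>

definition GL :: "nat \<Rightarrow> complex vec set \<Rightarrow> (complex vec \<Rightarrow> complex vec) set" where
  "GL n V = {T. linear_map class_ring (subsp n V) (subsp n V) T \<and> bij_betw T V V}"

text \<open>The \<open>j\<close>-th column of \<open>A\<close> holds the coordinates of \<open>T (\<beta> ! j)\<close> in the basis \<open>\<beta>\<close>.\<close>

definition represents ::
  "nat \<Rightarrow> complex vec list \<Rightarrow> (complex vec \<Rightarrow> complex vec) \<Rightarrow> complex mat \<Rightarrow> bool" where
  "represents n \<beta> T A \<longleftrightarrow> A \<in> carrier_mat (length \<beta>) (length \<beta>) \<and>
     (\<forall>j<length \<beta>. T (\<beta> ! j) = mat_of_cols n \<beta> *\<^sub>v col A j)"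

text \<open>The determinant of an endomorphism of \<open>V\<close>, which does not depend on the basis \<open>\<beta>\<close>.\<close>

definition det_on :: "nat \<Rightarrow> complex vec set \<Rightarrow> (complex vec \<Rightarrow> complex vec) \<Rightarrow> complex" where
  "det_on n V T =
     (THE d. \<exists>\<beta> A. ordered_basis n V \<beta> \<and> represents n \<beta> T A \<and> d = det A)"

definition GL_plus :: "nat \<Rightarrow> complex vec set \<Rightarrow> (complex vec \<Rightarrow> complex vec) set" where
  "GL_plus n V = {T \<in> GL n V. \<exists>r::real. r > 0 \<and> det_on n V T = complex_of_real r}"

definition orient_rel :: "nat \<Rightarrow> complex vec set \<Rightarrow> (complex vec list \<times> complex vec list) set" where
  "orient_rel n V = {(\<beta>\<^sub>1, \<beta>\<^sub>2). ordered_basis n V \<beta>\<^sub>1 \<and> ordered_basis n V \<beta>\<^sub>2 \<and>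
     (\<exists>S\<in>GL_plus n V. \<beta>\<^sub>2 = map S \<beta>\<^sub>1)}"

definition orientations :: "nat \<Rightarrow> complex vec set \<Rightarrow> complex vec list set set" where
  "orientations n V = {\<beta>. ordered_basis n V \<beta>} // orient_rel n V"

definition orientation_of :: "nat \<Rightarrow> complex vec set \<Rightarrow> complex vec list \<Rightarrow> complex vec list set" where
  "orientation_of n V \<beta> = orient_rel n V `` {\<beta>}"

definition canonical_orientation :: "nat \<Rightarrow> complex vec list set" where
  "canonical_orientation n = orientation_of n (carrier_vec n) (unit_vecs n)"

text \<open>
  The phase difference from one orientation to another, both given as equivalence classes; the
  value is the same for all representatives \<open>\<beta>\<^sub>0\<close> and \<open>\<beta>\<close>.
\<close>

definition phase_difference ::
  "nat \<Rightarrow> complex vec set \<Rightarrow> complex vec list set \<Rightarrow> complex vec list set \<Rightarrow> real" where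
  "phase_difference n V \<omega>\<^sub>0 \<omega> =
     (THE \<phi>. 0 \<le> \<phi> \<and> \<phi> < 2 * pi \<and>
        (\<exists>\<beta>\<^sub>0\<in>\<omega>\<^sub>0. \<exists>\<beta>\<in>\<omega>. \<exists>T\<in>GL n V. \<beta> = map T \<beta>\<^sub>0 \<and>
           (\<exists>r>0. det_on n V T = complex_of_real r * exp (\<i> * complex_of_real \<phi>))))"

end

theory Submission
  imports Defs "Jordan_Normal_Form.DL_Rank"
begin

text \<open>
  The whole statement rests on the multiplicativity of the determinant. A linear endomorphism \<open>T\<close>
  of \<open>\<complex>\<^sup>n\<close> is multiplication by a matrix \<open>A\<close>, so applying \<open>T\<close> to the entries of a list multiplies
  the matrix with these columns by \<open>A\<close> from the left. Hence, writing \<open>det \<beta>\<close> for the determinant of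
  the matrix with columns \<open>\<beta>\<close>, one has \<open>det (T \<beta>) = det T \<cdot> det \<beta>\<close> (\<open>det_mat_of_cols_map\<close>).

  Three facts complete the argument. Lists of \<open>n\<close> vectors with nonzero determinant are exactly the
  ordered bases (\<open>ordered_basis_carrier_vec_iff\<close>). Within one orientation, \<open>det \<beta>\<close> changes only by
  positive factors (\<open>orientation_of_det\<close>), so its argument is an invariant of the orientation,
  and it is \<open>0\<close> for the canonical one. And the map that takes the canonical basis to
  \<open>v\<^sub>1, \<dots>, v\<^sub>n\<close> has the matrix \<open>M(v\<^sub>1, \<dots>, v\<^sub>n)\<close>, so the phase of its determinant is the argument
  of \<open>det M(v\<^sub>1, \<dots>, v\<^sub>n)\<close>.

  Since the phase difference is a definite description ranging over all representatives of both
  orientations, it has to be shown that every choice of representatives yields this same angle: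
  if \<open>T\<close> takes \<open>\<beta>\<^sub>0\<close> to \<open>\<beta>\<close>, then \<open>det T\<close> is the quotient \<open>det \<beta> / det \<beta>\<^sub>0\<close>, which is a positive
  multiple of \<open>det M(v\<^sub>1, \<dots>, v\<^sub>n)\<close>.
\<close>

section \<open>Bases and determinants\<close>

lemma subsp_carrier_vec: "subsp n (carrier_vec n) = module_vec TYPE(complex) n"
  by (simp add: module_vec_def)

text \<open>
  A vanishing determinant amounts to a linear relation between the columns. In the other direction,
  \<open>n\<close> independent vectors also span, because the dimension of \<open>\<complex>\<^sup>n\<close> is \<open>n\<close>.
\<close>

lemma ordered_basis_carrier_vec_iff:
  "ordered_basis n (carrier_vec n) \<beta> \<longleftrightarrow>
     length \<beta> = n \<and> set \<beta> \<subseteq> carrier_vec n \<and> det (mat_of_cols n \<beta>) \<noteq> 0"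
  (is "?L \<longleftrightarrow> ?R")
proof -
  interpret V: vec_space "TYPE(complex)" n .
  have def: "?L \<longleftrightarrow> distinct \<beta> \<and> V.basis (set \<beta>)"
    unfolding ordered_basis_def subsp_carrier_vec ..
  show ?thesis
  proof
    assume ?L
    then have dist: "distinct \<beta>" and basis: "V.basis (set \<beta>)"
      using def by auto
    then have li: "V.lin_indpt (set \<beta>)" and carr: "set \<beta> \<subseteq> carrier_vec n"
      unfolding V.basis_def by auto
    have len: "length \<beta> = n"
      using V.dim_basis[OF _ basis] V.dim_is_n distinct_card[OF dist] by simp
    let ?B = "mat_of_cols n \<beta>"
    have B: "?B \<in> carrier_mat n n" using len mat_of_cols_carrier(1)[of n \<beta>] by simp
    have cols: "cols ?B = \<beta>" using carr by simp
    have "det ?B \<noteq> 0"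
    proof
      assume "det ?B = 0"
      then obtain v where v: "v \<in> carrier_vec n" "v \<noteq> 0\<^sub>v n" "?B *\<^sub>v v = 0\<^sub>v n"
        using det_0_iff_vec_prod_zero_field[OF B] by blast
      have "V.lin_dep (set (cols ?B))"
        using V.lin_depI[OF B v] dist cols by simp
      then show False using li cols by simp
    qed
    then show ?R using len carr by simp
  next
    assume R: ?R
    let ?B = "mat_of_cols n \<beta>"
    have B: "?B \<in> carrier_mat n n" using R mat_of_cols_carrier(1)[of n \<beta>] by simp
    have cols: "cols ?B = \<beta>" using R by simp
    have li: "V.lin_indpt (set \<beta>)"
      using V.lin_dep_cols_imp_det_0[OF B] R cols by auto
    \<comment> \<open>Independence of \<open>set \<beta>\<close> does not see repeated entries; two equal columns make the
      determinant vanish.\<close>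
    have dist: "distinct \<beta>"
    proof (rule ccontr)
      assume "\<not> distinct \<beta>"
      then obtain i j where "i \<noteq> j" "i < n" "j < n" "\<beta> ! i = \<beta> ! j"
        using R distinct_conv_nth by blast
      then have "det ?B = 0"
        using det_identical_columns[OF B, of i j] R col_mat_of_cols[of _ \<beta> n]
        by (metis nth_mem subset_eq)
      then show False using R by simp
    qed
    have "V.basis (set \<beta>)"
      using V.dim_li_is_basis[OF V.fin_dim _ _ li] R V.dim_is_n distinct_card[OF dist] by simp
    then show ?L using def dist by simp
  qed
qed

section \<open>Linear maps and matrices\<close>

lemma mat_of_cols_map_mult_mat_vec:
  assumes "A \<in> carrier_mat n n" and "set \<beta> \<subseteq> carrier_vec n"
    and T: "\<And>v. v \<in> carrier_vec n \<Longrightarrow> T v = A *\<^sub>v v"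
  shows "mat_of_cols n (map T \<beta>) = A * mat_of_cols n \<beta>"
proof -
  have "mat_of_cols n (map T \<beta>) $$ (i, j) = (A * mat_of_cols n \<beta>) $$ (i, j)"
    if "i < n" "j < length \<beta>" for i j
  proof -
    have "\<beta> ! j \<in> carrier_vec n" using assms that by auto
    then show ?thesis using assms that by (simp add: mat_of_cols_index)
  qed
  then show ?thesis using assms by (intro eq_matI) auto
qed

lemma mat_of_cols_unit_vecs: "mat_of_cols n (unit_vecs n) = 1\<^sub>m n"
  by (rule eq_matI) (auto simp: mat_of_cols_index unit_vecs_def)

lemma ordered_basis_unit_vecs: "ordered_basis n (carrier_vec n) (unit_vecs n)"
  by (simp add: ordered_basis_carrier_vec_iff mat_of_cols_unit_vecs vec_space.unit_vecs_length
      unit_vecs_carrier)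

lemma mult_mat_vec_unit_vec:
  fixes A :: "'a :: semiring_1 mat"
  assumes "A \<in> carrier_mat m n" and "j < n"
  shows "A *\<^sub>v unit_vec n j = col A j"
  using assms by (intro eq_vecI) auto

text \<open>
  A matrix times a vector is the linear combination of the columns whose coefficients are the
  entries of the vector, and \<open>T\<close> commutes with linear combinations. For the canonical basis this
  says that \<open>T\<close> is multiplication by the matrix whose columns are the images of the unit vectors.
\<close>

lemma linear_map_mat_of_cols_mult:
  assumes T: "linear_map class_ring (subsp n (carrier_vec n)) (subsp n (carrier_vec n)) T"
    and \<beta>: "set \<beta> \<subseteq> carrier_vec n" and c: "dim_vec c = length \<beta>"
  shows "T (mat_of_cols n \<beta> *\<^sub>v c) = mat_of_cols n (map T \<beta>) *\<^sub>v c"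
proof -
  interpret V: vec_space "TYPE(complex)" n .
  interpret T: linear_map class_ring V.V V.V T
    using T unfolding subsp_carrier_vec .
  have T_add: "T (u + w) = T u + T w" if "u \<in> carrier_vec n" "w \<in> carrier_vec n" for u w
    using T.f_add[of u w] that by simp
  have T_smult: "T (a \<cdot>\<^sub>v w) = a \<cdot>\<^sub>v T w" if "w \<in> carrier_vec n" for a w
    using T.f_smult[of a w] that by simp
  have T_carrier: "T w \<in> carrier_vec n" if "w \<in> carrier_vec n" for w
    using T.f_im[of w] that by simp
  have "T (V.lincomb_list f \<beta>) = V.lincomb_list f (map T \<beta>)" for f
    using \<beta>
  proof (induction \<beta> arbitrary: f)
    case Nil
    then show ?case using T.f0_is_0 by simp
  next
    case (Cons w ws)
    have "V.lincomb_list (f \<circ> Suc) ws \<in> carrier_vec n"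
      using Cons.prems V.lincomb_list_carrier[of ws] by simp
    then show ?case using Cons by (simp add: T_add T_smult)
  qed
  moreover have "V.lincomb_list (($) c) ws = mat_of_cols n ws *\<^sub>v c"
    if "set ws \<subseteq> carrier_vec n" "length ws = length \<beta>" for ws
  proof -
    have "Matrix.vec (length ws) (($) c) = c" using c that(2) by auto
    moreover have "\<forall>w\<in>set ws. dim_vec w = n" using that(1) by auto
    ultimately show ?thesis using V.lincomb_list_as_mat_mult[of ws "($) c"] by simp
  qed
  moreover have "set (map T \<beta>) \<subseteq> carrier_vec n" using \<beta> T_carrier by auto
  ultimately show ?thesis using \<beta> by (metis length_map)
qed

lemma linear_map_carrier_vec_obtain_mat:
  assumes T: "linear_map class_ring (subsp n (carrier_vec n)) (subsp n (carrier_vec n)) T"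
  obtains A where "A \<in> carrier_mat n n" "\<And>v. v \<in> carrier_vec n \<Longrightarrow> T v = A *\<^sub>v v"
proof
  show "mat_of_cols n (map T (unit_vecs n)) \<in> carrier_mat n n"
    using mat_of_cols_carrier(1)[of n "map T (unit_vecs n)"] by (simp add: unit_vecs_def)
  show "T v = mat_of_cols n (map T (unit_vecs n)) *\<^sub>v v" if "v \<in> carrier_vec n" for v
    using linear_map_mat_of_cols_mult[OF T unit_vecs_carrier, of v] that
    by (simp add: mat_of_cols_unit_vecs vec_space.unit_vecs_length)
qed

lemma mult_mat_vec_in_GL:
  assumes A: "A \<in> carrier_mat n n" and det: "det A \<noteq> 0"
  shows "(\<lambda>v. A *\<^sub>v v) \<in> GL n (carrier_vec n)"
proof -
  interpret V: vec_space "TYPE(complex)" n .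
  have "linear_map class_ring V.V V.V ((*\<^sub>v) A)"
    using A
    by (intro linear_map.intro mod_hom.intro mod_hom_axioms.intro vec_vs V.module_axioms)
      (auto simp: module_hom_def mult_add_distrib_mat_vec mult_mat_vec)
  moreover
  obtain B where B: "B \<in> carrier_mat n n" "B * A = 1\<^sub>m n" "A * B = 1\<^sub>m n"
    using det_non_zero_imp_unit[OF A det, of "()"] by (auto simp: Units_def ring_mat_simps)
  have "bij_betw ((*\<^sub>v) A) (carrier_vec n) (carrier_vec n)"
    by (rule bij_betw_byWitness[where f' = "(*\<^sub>v) B"])
      (use A B in \<open>auto simp: assoc_mult_mat_vec[symmetric]\<close>)
  ultimately show ?thesis
    unfolding GL_def subsp_carrier_vec by simp
qed

text \<open>
  The canonical basis provides a representing matrix, namely \<open>A\<close> itself. If \<open>A'\<close> represents \<open>T\<close> in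
  a basis with matrix \<open>B\<close>, then comparing columns gives \<open>A B = B A'\<close>, and \<open>det B \<noteq> 0\<close> cancels; so
  the definite description in \<open>det_on\<close> is well-defined.
\<close>

lemma det_on_eq_det:
  assumes A: "A \<in> carrier_mat n n" and T: "\<And>v. v \<in> carrier_vec n \<Longrightarrow> T v = A *\<^sub>v v"
  shows "det_on n (carrier_vec n) T = det A"
  unfolding det_on_def
proof (rule the_equality)
  have "represents n (unit_vecs n) T A"
    unfolding represents_def using A T
    by (simp add: vec_space.unit_vecs_length mat_of_cols_unit_vecs)
      (auto simp: unit_vecs_def mult_mat_vec_unit_vec)
  then show "\<exists>\<beta> A'. ordered_basis n (carrier_vec n) \<beta> \<and> represents n \<beta> T A' \<and> det A = det A'"
    using ordered_basis_unit_vecs by blast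
next
  fix d assume "\<exists>\<beta> A'. ordered_basis n (carrier_vec n) \<beta> \<and> represents n \<beta> T A' \<and> d = det A'"
  then obtain \<beta> A' where "ordered_basis n (carrier_vec n) \<beta>"
    and rep: "represents n \<beta> T A'" and d: "d = det A'" by blast
  then have len: "length \<beta> = n" and carr: "set \<beta> \<subseteq> carrier_vec n"
    and det: "det (mat_of_cols n \<beta>) \<noteq> 0"
    by (auto simp: ordered_basis_carrier_vec_iff)
  let ?B = "mat_of_cols n \<beta>"
  have B: "?B \<in> carrier_mat n n" using len mat_of_cols_carrier(1)[of n \<beta>] by simp
  have A': "A' \<in> carrier_mat n n" using rep len by (simp add: represents_def)
  have "A * ?B = ?B * A'"
  proof (rule mat_col_eqI)
    fix j assume "j < dim_col (?B * A')"
    then have j: "j < n" using A' by simp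
    have "\<beta> ! j \<in> carrier_vec n" using carr len j by auto
    then have "col (A * ?B) j = T (\<beta> ! j)"
      using col_mult2[OF A B j] col_mat_of_cols[of j \<beta> n] j len T by simp
    also have "\<dots> = col (?B * A') j"
      using rep j len col_mult2[OF B A' j] by (simp add: represents_def)
    finally show "col (A * ?B) j = col (?B * A') j" .
  qed (use A A' B in auto)
  then have "det A * det ?B = det A' * det ?B"
    using det_mult[OF A B] det_mult[OF B A'] by (metis mult.commute)
  then show "d = det A" using det d by simp
qed

lemma det_mat_of_cols_map:
  assumes T: "T \<in> GL n (carrier_vec n)" and \<beta>: "length \<beta> = n" "set \<beta> \<subseteq> carrier_vec n"
  shows "det (mat_of_cols n (map T \<beta>)) = det_on n (carrier_vec n) T * det (mat_of_cols n \<beta>)"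
proof -
  from T have "linear_map class_ring (subsp n (carrier_vec n)) (subsp n (carrier_vec n)) T"
    by (simp add: GL_def)
  then obtain A where A: "A \<in> carrier_mat n n" "\<And>v. v \<in> carrier_vec n \<Longrightarrow> T v = A *\<^sub>v v"
    using linear_map_carrier_vec_obtain_mat by blast
  have "mat_of_cols n \<beta> \<in> carrier_mat n n"
    using \<beta> mat_of_cols_carrier(1)[of n \<beta>] by simp
  then show ?thesis
    using mat_of_cols_map_mult_mat_vec[OF A(1) \<beta>(2) A(2)] det_on_eq_det[OF A] det_mult[OF A(1)]
    by simp
qed

section \<open>Orientations and the phase difference\<close>

text \<open>The identity is multiplication by the unit matrix, whose determinant \<open>1\<close> is positive.\<close>

lemma mem_orientation_of_self:
  assumes "ordered_basis n (carrier_vec n) \<beta>"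
  shows "\<beta> \<in> orientation_of n (carrier_vec n) \<beta>"
proof -
  let ?S = "\<lambda>v. (1\<^sub>m n :: complex mat) *\<^sub>v v"
  have "det_on n (carrier_vec n) ?S = complex_of_real 1"
    using det_on_eq_det[of "1\<^sub>m n" n ?S] by simp
  moreover have "?S \<in> GL n (carrier_vec n)"
    by (rule mult_mat_vec_in_GL) simp_all
  ultimately have "?S \<in> GL_plus n (carrier_vec n)"
    unfolding GL_plus_def by (intro CollectI conjI exI[of _ 1]) simp_all
  moreover have "map ?S \<beta> = \<beta>"
    using assms by (intro map_idI) (auto simp: ordered_basis_carrier_vec_iff)
  ultimately have "\<exists>S \<in> GL_plus n (carrier_vec n). \<beta> = map S \<beta>"
    by (intro bexI[of _ ?S]) simp_all
  then show ?thesis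
    using assms unfolding orientation_of_def orient_rel_def by blast
qed

lemma orientation_of_det:
  assumes "\<gamma> \<in> orientation_of n (carrier_vec n) \<beta>"
  obtains r where "r > 0" "det (mat_of_cols n \<gamma>) = complex_of_real r * det (mat_of_cols n \<beta>)"
proof -
  from assms obtain S where \<beta>: "ordered_basis n (carrier_vec n) \<beta>"
    and S: "S \<in> GL_plus n (carrier_vec n)" and \<gamma>: "\<gamma> = map S \<beta>"
    unfolding orientation_of_def orient_rel_def by auto
  from S obtain r where "S \<in> GL n (carrier_vec n)" "r > 0"
    "det_on n (carrier_vec n) S = complex_of_real r"
    unfolding GL_plus_def by auto
  then show ?thesis
    using that det_mat_of_cols_map[of S n \<beta>] \<beta> \<gamma> by (auto simp: ordered_basis_carrier_vec_iff)
qed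

theorem corollary3p3:
  fixes n :: nat and vs :: "complex vec list"
  assumes "length vs = n" and "set vs \<subseteq> carrier_vec n"
    and "det (mat_of_cols n vs) \<noteq> 0"
  shows "ordered_basis n (carrier_vec n) vs \<and>
    phase_difference n (carrier_vec n) (canonical_orientation n)
      (orientation_of n (carrier_vec n) vs) = Arg2pi (det (mat_of_cols n vs))"
proof
  let ?V = "carrier_vec n :: complex vec set" and ?e = "unit_vecs n :: complex vec list"
  let ?M = "mat_of_cols n vs"
  have M: "?M \<in> carrier_mat n n" using assms(1) mat_of_cols_carrier(1)[of n vs] by simp
  show vs: "ordered_basis n ?V vs"
    using assms by (simp add: ordered_basis_carrier_vec_iff)
  show "phase_difference n ?V (canonical_orientation n) (orientation_of n ?V vs) = Arg2pi (det ?M)"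
    unfolding phase_difference_def
  proof (rule the_equality)
    \<comment> \<open>Existence: the canonical basis and \<open>vs\<close> are related by multiplication by \<open>?M\<close>.\<close>
    let ?T = "\<lambda>v. ?M *\<^sub>v v"
    have map: "vs = map ?T ?e"
    proof (rule nth_equalityI)
      fix i assume "i < length vs"
      moreover from this have "vs ! i \<in> carrier_vec n" using assms(2) by auto
      ultimately show "vs ! i = map ?T ?e ! i"
        using assms(1) by (simp add: unit_vecs_def mult_mat_vec_unit_vec[OF M])
    qed (simp add: assms(1) unit_vecs_def)
    have T: "?T \<in> GL n ?V" using mult_mat_vec_in_GL[OF M assms(3)] .
    have "det_on n ?V ?T
        = complex_of_real (cmod (det ?M)) * exp (\<i> * complex_of_real (Arg2pi (det ?M)))"
      using det_on_eq_det[OF M, of ?T] Arg2pi_eq[of "det ?M"] by simp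
    moreover have "cmod (det ?M) > 0" using assms(3) by simp
    ultimately have "\<exists>r>0. det_on n ?V ?T
        = complex_of_real r * exp (\<i> * complex_of_real (Arg2pi (det ?M)))" by blast
    moreover have "?e \<in> canonical_orientation n"
      unfolding canonical_orientation_def by (rule mem_orientation_of_self[OF ordered_basis_unit_vecs])
    moreover note mem_orientation_of_self[OF vs] map T Arg2pi_ge_0[of "det ?M"]
      Arg2pi_lt_2pi[of "det ?M"]
    ultimately show "0 \<le> Arg2pi (det ?M) \<and> Arg2pi (det ?M) < 2 * pi \<and>
      (\<exists>\<beta>\<^sub>0\<in>canonical_orientation n. \<exists>\<beta>\<in>orientation_of n ?V vs. \<exists>T\<in>GL n ?V. \<beta> = map T \<beta>\<^sub>0 \<and>
        (\<exists>r>0. det_on n ?V T = complex_of_real r * exp (\<i> * complex_of_real (Arg2pi (det ?M)))))"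
      by blast
  next
    \<comment> \<open>Uniqueness: for arbitrary representatives, \<open>det T\<close> differs from \<open>det ?M\<close> by a positive
      factor \<open>t / s\<close>, where \<open>s\<close> and \<open>t\<close> account for the choice of \<open>\<beta>\<^sub>0\<close> and \<open>\<beta>\<close>.\<close>
    fix \<phi>
    assume \<phi>: "0 \<le> \<phi> \<and> \<phi> < 2 * pi \<and>
      (\<exists>\<beta>\<^sub>0\<in>canonical_orientation n. \<exists>\<beta>\<in>orientation_of n ?V vs. \<exists>T\<in>GL n ?V. \<beta> = map T \<beta>\<^sub>0 \<and>
        (\<exists>r>0. det_on n ?V T = complex_of_real r * exp (\<i> * complex_of_real \<phi>)))"
    then obtain \<beta>\<^sub>0 \<beta> T r where \<beta>\<^sub>0: "\<beta>\<^sub>0 \<in> orientation_of n ?V ?e"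
      and \<beta>: "\<beta> \<in> orientation_of n ?V vs" and T: "T \<in> GL n ?V" "\<beta> = map T \<beta>\<^sub>0"
      and r: "r > 0" "det_on n ?V T = complex_of_real r * exp (\<i> * complex_of_real \<phi>)"
      unfolding canonical_orientation_def by blast
    obtain s where s: "s > 0" "det (mat_of_cols n \<beta>\<^sub>0) = complex_of_real s"
      using orientation_of_det[OF \<beta>\<^sub>0] by (auto simp: mat_of_cols_unit_vecs)
    obtain t where t: "t > 0" "det (mat_of_cols n \<beta>) = complex_of_real t * det ?M"
      using orientation_of_det[OF \<beta>] .
    have "ordered_basis n ?V \<beta>\<^sub>0"
      using \<beta>\<^sub>0 by (auto simp: orientation_of_def orient_rel_def)
    then have "complex_of_real t * det ?M = det_on n ?V T * complex_of_real s"
      using det_mat_of_cols_map[OF T(1), of \<beta>\<^sub>0] T(2) s t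
      by (auto simp: ordered_basis_carrier_vec_iff)
    then have "complex_of_real (r * s / t) * exp (\<i> * complex_of_real \<phi>) = det ?M"
      using r t(1) by (simp add: field_simps)
    then show "\<phi> = Arg2pi (det ?M)"
      using Arg2pi_unique[of "r * s / t" \<phi> "det ?M"] r(1) s(1) t(1) \<phi> by simp
  qed
qed

end
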